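(* Let $n\ge 1$, $m\ge 1$, let $f\in\mathbb{R}[x_1,\dots,x_n]$, let $d$ be an even integer with $d\ge\max\{2,\deg(f)\}$, let $N_1,\dots,N_n$ be positive real numbers, let $I_1,\dots,I_m$ be a partition of $\{1,\dots,n\}$, and let $g_j:=1-\sum_{i\in I_j}\left(\frac{x_i}{N_i}\right)^d$ for $j=1,\dots,m$, $\mathbf{g}:=(g_1,\dots,g_m)$. Let $c_j:=\max\left(\{f_{d,i}N_i^d : i\in I_j\}\cup\{0\}\right)$ for $j=1,\dots,m$. Then $$s(f,\mathbf{g})=f(0)+\sum_{j=1}^m c_j-\rho,$$ where $\rho$ denotes the optimum value of the following program, which is a geometric program: $$\left\{\begin{array}{ll} \text{Minimize} & \displaystyle\sum_{j=1}^m\mu_j+\sum_{\alpha\in\Delta(f)^{<d}}(d-|\alpha|)\left[\left(\frac{f_\alpha}{d}\right)^d\left(\frac{\alpha}{\mathbf{z}_\alpha}\right)^\alpha\right]^{1/(d-|\alpha|)}\\[2ex] \text{subject to} & \displaystyle\sum_{\alpha\in\Delta(f)}z_{\alpha,i}+\left(\frac{c_j}{N_i^d}-f_{d,i}\right)\le\frac{\mu_j}{N_i^d}\quad\text{for all } i\in I_j,\ j=1,\dots,m,\\[2ex] & \displaystyle\left(\frac{\mathbf{z}_\alpha}{\alpha}\right)^\alpha=\left(\frac{f_\alpha}{d}\right)^d\quad\text{for all }\alpha\in\Delta(f)^{=d},\\[2ex] & c_j\le\mu_j\quad\text{for } j=1,\dots,m. \end{array}\right.$$ Here the unknowns are the vectors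 $\mathbf{z}_\alpha=(z_{\alpha,1},\dots,z_{\alpha,n})\in[0,\infty)^n$ for $\alpha\in\Delta(f)$, required to satisfy $z_{\alpha,i}=0$ if and only if $\alpha_i=0$, and $\mu=(\mu_1,\dots,\mu_m)$, required to satisfy $\mu_j>0$ for all $j$.
   Context: Notation. $\mathbb{N}=\{0,1,2,\dots\}$; for $\alpha\in\mathbb{N}^n$, $|\alpha|=\sum_i\alpha_i$ and $\mathbf{x}^\alpha=\prod_i x_i^{\alpha_i}$. Fix an even integer $d\ge2$. Let $\epsilon_i\in\mathbb{N}^n$ have $i$-th entry $d$ and all other entries $0$. For $h=\sum_\alpha h_\alpha\mathbf{x}^\alpha\in\mathbb{R}[x_1,\dots,x_n]$ with $\deg(h)\le d$, write $h_{d,i}:=h_{\epsilon_i}$ (the coefficient of $x_i^d$), $h(0)$ for the constant term, and - $\Omega(h):=\{\alpha\in\mathbb{N}^n : |\alpha|\le d,\ h_\alpha\ne0\}\setminus\{0,\epsilon_1,\dots,\epsilon_n\}$; - $\Delta(h):=\{\alpha\in\Omega(h): h_\alpha\mathbf{x}^\alpha \text{ is not a square in }\mathbb{R}[x_1,\dots,x_n]\}$; - $\Delta(h)^{<d}:=\{\alpha\in\Delta(h):|\alpha|<d\}$ and $\Delta(h)^{=d}:=\{\alpha\in\Delta(h):|\alpha|=d\}$. For $\mathbf{z}_\alpha=(z_{\alpha,i})\in[0,\infty)^n$ with $z_{\alpha,i}=0$ iff $\alpha_i=0$, put $\left(\frac{\alpha}{\mathbf{z}_\alpha}\right)^\alpha:=\prod_{i=1}^n\frac{\alpha_i^{\alpha_i}}{(z_{\alpha,i})^{\alpha_i}}$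 and $\left(\frac{\mathbf{z}_\alpha}{\alpha}\right)^\alpha:=\prod_{i=1}^n\frac{(z_{\alpha,i})^{\alpha_i}}{\alpha_i^{\alpha_i}}$, with the convention $0^0=1$. The bound $h_{\mathrm{gp}}$. For $h$ with $\deg(h)\le d$, let $\rho(h)$ be the optimal value (infimum, equal to $+\infty$ if there is no feasible point) of: minimize $\sum_{\alpha\in\Delta(h)^{<d}}(d-|\alpha|)\left[\left(\frac{h_\alpha}{d}\right)^d\left(\frac{\alpha}{\mathbf{z}_\alpha}\right)^\alpha\right]^{1/(d-|\alpha|)}$ subject to $\sum_{\alpha\in\Delta(h)}z_{\alpha,i}\le h_{d,i}$ for $i=1,\dots,n$ and $\left(\frac{\mathbf{z}_\alpha}{\alpha}\right)^\alpha=\left(\frac{h_\alpha}{d}\right)^d$ for $\alpha\in\Delta(h)^{=d}$, over unknowns $\mathbf{z}_\alpha\in[0,\infty)^n$, $\alpha\in\Delta(h)$, with $z_{\alpha,i}=0$ iff $\alpha_i=0$. Set $h_{\mathrm{gp}}:=h(0)-\rho(h)\in\mathbb{R}\cup\{-\infty\}$. The bound $s(f,\mathbf{g})$. For $f,g_1,\dots,g_m$ of degree at most $d$ and $\lambda\in[0,\infty)^m$ let $G(\lambda):=f-\sum_{j=1}^m\lambda_jg_j$, and define $s(f,\mathbf{g}):=\sup\{G(\lambda)_{\mathrm{gp}}:\lambda\in[0,\infty)^m\}$, where $G(\lambda)_{\mathrm{gp}}$ is formed with the fixed integer $d$. Geometric programs. A monomial function on $(0,\infty)^k$ is a function $c\,x_1^{a_1}\cdots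 x_k^{a_k}$ with $c>0$, $a_i\in\mathbb{R}$; a posynomial is a sum of monomial functions. A geometric program is a problem of minimizing a posynomial $\phi_0$ over $(0,\infty)^k$ subject to $\phi_i\le1$ (finitely many posynomials $\phi_i$) and $\psi_j=1$ (finitely many monomial functions $\psi_j$). When a program whose unknowns are vectors $\mathbf{z}_\alpha=(z_{\alpha,i})\in[0,\infty)^n$, $\alpha\in\Delta(f)$, with $z_{\alpha,i}=0$ iff $\alpha_i=0$, together with $\mu=(\mu_1,\dots,\mu_m)$ with all $\mu_j>0$, is called a geometric program, the positive variables are the $\mu_j$ and those $z_{\alpha,i}$ with $\alpha_i\neq 0$ (the others being fixed to be $0$), constraints are rewritten in the form $\phi\le1$ with $\phi$ a posynomial, or $\psi=1$ with $\psi$ a monomial function, by dividing by a monomial, and constraints reducing to $0\le 1$ are dropped. The optimum value of a minimization program means the infimum of the objective over its feasible set. *)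

theory Defs
  imports
    "HOL-Analysis.Analysis"
    "HOL-Library.Poly_Mapping"
    "HOL-Library.Disjoint_Sets"
begin

section \<open>Polynomials in n variables\<close>

text \<open>
  The variables are indexed by a finite type \<open>'n\<close> (so \<open>n = CARD('n)\<close>), exponent vectors are
  elements of \<open>nat ^ 'n\<close>, and the polynomial ring is the monoid algebra of finitely supported
  coefficient functions, with the ring structure of \<open>Poly_Mapping\<close>.  Thus \<open>lookup h \<alpha>\<close> is the
  coefficient of \<open>h\<close> at \<open>\<alpha>\<close>, and \<open>Poly_Mapping.single \<alpha> a\<close> is the term with coefficient \<open>a\<close> and
  exponent vector \<open>\<alpha>\<close>.
\<close>

type_synonym 'n rpoly = "(nat ^ 'n) \<Rightarrow>\<^sub>0 real"

abbreviation mcoeff :: "'n::finite rpoly \<Rightarrow> nat ^ 'n \<Rightarrow> real"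
  where "mcoeff \<equiv> Poly_Mapping.lookup"

definition Const :: "real \<Rightarrow> 'n::finite rpoly"
  where "Const a = Poly_Mapping.single 0 a"

definition Var :: "'n::finite \<Rightarrow> 'n rpoly"
  where "Var i = Poly_Mapping.single (axis i 1) 1"

definition size_exp :: "nat ^ 'n::finite \<Rightarrow> nat"
  where "size_exp \<alpha> = (\<Sum>i\<in>UNIV. \<alpha> $ i)"

text \<open>Total degree; the zero polynomial is given degree 0.\<close>

definition total_degree :: "'n::finite rpoly \<Rightarrow> nat"
  where "total_degree h = Max (insert 0 (size_exp ` Poly_Mapping.keys h))"

definition Omega :: "nat \<Rightarrow> 'n::finite rpoly \<Rightarrow> (nat ^ 'n) set"
  where "Omega d h =
    {\<alpha>. size_exp \<alpha> \<le> d \<and> mcoeff h \<alpha> \<noteq> 0} - insert 0 (range (\<lambda>i. axis i d))"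

definition Delta :: "nat \<Rightarrow> 'n::finite rpoly \<Rightarrow> (nat ^ 'n) set"
  where "Delta d h =
    {\<alpha> \<in> Omega d h. \<not> (\<exists>q :: 'n rpoly. Poly_Mapping.single \<alpha> (mcoeff h \<alpha>) = q ^ 2)}"

definition Delta_less :: "nat \<Rightarrow> 'n::finite rpoly \<Rightarrow> (nat ^ 'n) set"
  where "Delta_less d h = {\<alpha> \<in> Delta d h. size_exp \<alpha> < d}"

definition Delta_eq :: "nat \<Rightarrow> 'n::finite rpoly \<Rightarrow> (nat ^ 'n) set"
  where "Delta_eq d h = {\<alpha> \<in> Delta d h. size_exp \<alpha> = d}"

text \<open>In the following two products \<open>0 ^ 0 = 1\<close> is the library's convention.\<close>

definition exp_over :: "nat ^ 'n::finite \<Rightarrow> real ^ 'n \<Rightarrow> real"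
  where "exp_over \<alpha> z = (\<Prod>i\<in>UNIV. real (\<alpha> $ i) ^ (\<alpha> $ i) / (z $ i) ^ (\<alpha> $ i))"

definition over_exp :: "real ^ 'n::finite \<Rightarrow> nat ^ 'n \<Rightarrow> real"
  where "over_exp z \<alpha> = (\<Prod>i\<in>UNIV. (z $ i) ^ (\<alpha> $ i) / real (\<alpha> $ i) ^ (\<alpha> $ i))"


section \<open>Minimization programs\<close>

text \<open>
  A constraint is stored as the pair of functions forming its left-hand and right-hand side.
\<close>

record 'a program =
  points :: "'a set"
  objective :: "'a \<Rightarrow> real"
  le_constraints :: "(('a \<Rightarrow> real) \<times> ('a \<Rightarrow> real)) set"
  eq_constraints :: "(('a \<Rightarrow> real) \<times> ('a \<Rightarrow> real)) set"

definition feasible :: "'a program \<Rightarrow> 'a set"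
  where "feasible P = {x \<in> points P.
    (\<forall>(l, r) \<in> le_constraints P. l x \<le> r x) \<and> (\<forall>(l, r) \<in> eq_constraints P. l x = r x)}"

text \<open>The infimum of the empty set in \<^typ>\<open>ereal\<close> is \<open>\<infinity>\<close>.\<close>

definition optimum_value :: "'a program \<Rightarrow> ereal"
  where "optimum_value P = (INF x \<in> feasible P. ereal (objective P x))"


section \<open>Geometric programs\<close>

text \<open>The positive variables are indexed by a finite set \<open>V\<close>.\<close>

definition pos_orthant :: "'v set \<Rightarrow> ('v \<Rightarrow> real) set"
  where "pos_orthant V = (\<Pi>\<^sub>E v\<in>V. {0<..})"

definition monomial_function :: "'v set \<Rightarrow> (('v \<Rightarrow> real) \<Rightarrow> real) \<Rightarrow> bool"
  where "monomial_function V \<psi> \<longleftrightarrow>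
    (\<exists>c > 0. \<exists>a :: 'v \<Rightarrow> real. \<forall>x \<in> pos_orthant V. \<psi> x = c * (\<Prod>v\<in>V. x v powr a v))"

text \<open>A sum of at least one monomial function; in particular the zero function is excluded.\<close>

definition posynomial :: "'v set \<Rightarrow> (('v \<Rightarrow> real) \<Rightarrow> real) \<Rightarrow> bool"
  where "posynomial V \<phi> \<longleftrightarrow>
    (\<exists>(p :: nat) M. p \<ge> 1 \<and> (\<forall>k<p. monomial_function V (M k)) \<and>
      (\<forall>x \<in> pos_orthant V. \<phi> x = (\<Sum>k<p. M k x)))"

definition geometric_program :: "'v set \<Rightarrow> ('v \<Rightarrow> real) program \<Rightarrow> bool"
  where "geometric_program V Q \<longleftrightarrow>
    finite V \<and> points Q = pos_orthant V \<and>
    posynomial V (objective Q) \<and>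
    finite (le_constraints Q) \<and> finite (eq_constraints Q) \<and>
    (\<forall>(l, r) \<in> le_constraints Q. posynomial V l \<and> (\<forall>x \<in> pos_orthant V. r x = 1)) \<and>
    (\<forall>(l, r) \<in> eq_constraints Q. monomial_function V l \<and> (\<forall>x \<in> pos_orthant V. r x = 1))"

text \<open>
  Rewriting of a program along a parametrization \<open>e\<close> of its points by \<open>pos_orthant V\<close>: every
  constraint is divided by its right-hand side, and inequalities that become \<open>0 \<le> 1\<close> are dropped.
  This is only meaningful when the right-hand sides are monomial functions of the positive
  variables, which is part of \<open>is_geometric_program\<close> below.
\<close>

definition normal_form :: "'v set \<Rightarrow> (('v \<Rightarrow> real) \<Rightarrow> 'a) \<Rightarrow> 'a program \<Rightarrow> ('v \<Rightarrow> real) program"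
  where "normal_form V e P =
    \<lparr> points = pos_orthant V,
      objective = (\<lambda>x. objective P (e x)),
      le_constraints = {(\<lambda>x. l (e x) / r (e x), \<lambda>x. 1) | l r.
        (l, r) \<in> le_constraints P \<and> \<not> (\<forall>x \<in> pos_orthant V. l (e x) / r (e x) = 0)},
      eq_constraints = {(\<lambda>x. l (e x) / r (e x), \<lambda>x. 1) | l r. (l, r) \<in> eq_constraints P} \<rparr>"

definition is_geometric_program :: "'v set \<Rightarrow> (('v \<Rightarrow> real) \<Rightarrow> 'a) \<Rightarrow> 'a program \<Rightarrow> bool"
  where "is_geometric_program V e P \<longleftrightarrow>
    bij_betw e (pos_orthant V) (points P) \<and>
    (\<forall>(l, r) \<in> le_constraints P \<union> eq_constraints P. monomial_function V (\<lambda>x. r (e x))) \<and>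
    geometric_program V (normal_form V e P)"


section \<open>The bounds\<close>

text \<open>
  The admissible families of vectors \<open>z \<alpha>\<close> for \<open>\<alpha> \<in> D\<close>; they are extensional outside \<open>D\<close>.
\<close>

definition z_families :: "(nat ^ 'n::finite) set \<Rightarrow> (nat ^ 'n \<Rightarrow> real ^ 'n) set"
  where "z_families D =
    (\<Pi>\<^sub>E \<alpha>\<in>D. {w. \<forall>i. 0 \<le> w $ i \<and> (w $ i = 0 \<longleftrightarrow> \<alpha> $ i = 0)})"

definition gp_objective :: "nat \<Rightarrow> 'n::finite rpoly \<Rightarrow> (nat ^ 'n \<Rightarrow> real ^ 'n) \<Rightarrow> real"
  where "gp_objective d h z =
    (\<Sum>\<alpha>\<in>Delta_less d h. (real d - real (size_exp \<alpha>)) *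
      ((mcoeff h \<alpha> / real d) ^ d * exp_over \<alpha> (z \<alpha>))
        powr (1 / (real d - real (size_exp \<alpha>))))"

definition rho_program :: "nat \<Rightarrow> 'n::finite rpoly \<Rightarrow> (nat ^ 'n \<Rightarrow> real ^ 'n) program"
  where "rho_program d h =
    \<lparr> points = z_families (Delta d h),
      objective = gp_objective d h,
      le_constraints =
        {(\<lambda>z. \<Sum>\<alpha>\<in>Delta d h. z \<alpha> $ i, \<lambda>z. mcoeff h (axis i d)) | i. True},
      eq_constraints =
        {(\<lambda>z. over_exp (z \<alpha>) \<alpha>, \<lambda>z. (mcoeff h \<alpha> / real d) ^ d) | \<alpha>. \<alpha> \<in> Delta_eq d h} \<rparr>"

definition gp_bound :: "nat \<Rightarrow> 'n::finite rpoly \<Rightarrow> ereal"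
  where "gp_bound d h = ereal (mcoeff h 0) - optimum_value (rho_program d h)"

definition s_bound :: "nat \<Rightarrow> 'n::finite rpoly \<Rightarrow> ('m::finite \<Rightarrow> 'n rpoly) \<Rightarrow> ereal"
  where "s_bound d f g =
    (SUP l \<in> {l :: real ^ 'm. \<forall>j. 0 \<le> l $ j}.
      gp_bound d (f - (\<Sum>j\<in>UNIV. Const (l $ j) * g j)))"


section \<open>The program for a partition of the variables\<close>

definition partition_program ::
  "nat \<Rightarrow> 'n::finite rpoly \<Rightarrow> ('n \<Rightarrow> real) \<Rightarrow> ('m::finite \<Rightarrow> 'n set) \<Rightarrow> ('m \<Rightarrow> real) \<Rightarrow>
    ((nat ^ 'n \<Rightarrow> real ^ 'n) \<times> (real ^ 'm)) program"
  where "partition_program d f N I c =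
    \<lparr> points = z_families (Delta d f) \<times> {\<mu>. \<forall>j. 0 < \<mu> $ j},
      objective = (\<lambda>(z, \<mu>). (\<Sum>j\<in>UNIV. \<mu> $ j) + gp_objective d f z),
      le_constraints =
        {(\<lambda>(z, \<mu>). (\<Sum>\<alpha>\<in>Delta d f. z \<alpha> $ i) + (c j / N i ^ d - mcoeff f (axis i d)),
          \<lambda>(z, \<mu>). \<mu> $ j / N i ^ d) | i j. i \<in> I j} \<union>
        {(\<lambda>(z, \<mu>). c j, \<lambda>(z, \<mu>). \<mu> $ j) | j. True},
      eq_constraints =
        {(\<lambda>(z, \<mu>). over_exp (z \<alpha>) \<alpha>, \<lambda>(z, \<mu>). (mcoeff f \<alpha> / real d) ^ d) | \<alpha>.
          \<alpha> \<in> Delta_eq d f} \<rparr>"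

text \<open>
  The positive variables of this program: the \<open>z\<^sub>\<alpha>\<^sub>i\<close> with \<open>\<alpha> $ i \<noteq> 0\<close> (left summand) and the
  \<open>\<mu>\<^sub>j\<close> (right summand).  The remaining \<open>z\<^sub>\<alpha>\<^sub>i\<close> are fixed to be 0.
\<close>

definition positive_vars :: "nat \<Rightarrow> 'n::finite rpoly \<Rightarrow> ((nat ^ 'n) \<times> 'n + 'm::finite) set"
  where "positive_vars d f = {(\<alpha>, i). \<alpha> \<in> Delta d f \<and> \<alpha> $ i \<noteq> 0} <+> UNIV"

definition from_positive_vars ::
  "nat \<Rightarrow> 'n::finite rpoly \<Rightarrow> ((nat ^ 'n) \<times> 'n + 'm::finite \<Rightarrow> real) \<Rightarrow>
    (nat ^ 'n \<Rightarrow> real ^ 'n) \<times> (real ^ 'm)"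
  where "from_positive_vars d f x =
    (\<lambda>\<alpha>\<in>Delta d f. \<chi> i. if \<alpha> $ i = 0 then 0 else x (Inl (\<alpha>, i)),
     \<chi> j. x (Inr j))"

end

theory Submission
  imports Defs
begin

text \<open>
  Since \<open>g\<^sub>j\<close> involves only the constant term and the pure powers \<open>x\<^sub>i ^ d\<close>, passing from \<open>f\<close> to
  the Lagrangian \<open>G(\<lambda>) = f - (\<Sum>j. \<lambda>\<^sub>j * g\<^sub>j)\<close> leaves every coefficient entering \<open>\<Delta>\<close> untouched.  It
  lowers the constant term by \<open>\<Sum>j. \<lambda>\<^sub>j\<close> and raises the coefficient of \<open>x\<^sub>i ^ d\<close> by
  \<open>\<lambda>\<^sub>j / N\<^sub>i ^ d\<close>, where \<open>i \<in> I\<^sub>j\<close> (lemmas \<open>lookup_lagrangian\<close>, \<open>Delta_lagrangian\<close>).  The programs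
  defining the bounds \<open>G(\<lambda>)\<^sub>g\<^sub>p\<close> therefore share their objective and their equality constraints, and the
  supremum over \<open>\<lambda>\<close> merges them into one program in \<open>(z, \<lambda>)\<close>.

  The substitution \<open>\<mu> = \<lambda> + c\<close> turns this program into the stated one (\<open>feasible_shift_iff\<close>), with
  the constant \<open>\<Sum>j. c\<^sub>j\<close> moved out of the objective.  The only discrepancy is that
  \<open>\<mu>\<^sub>j\<close> must be positive, whereas \<open>\<lambda>\<^sub>j + c\<^sub>j\<close> may vanish.  Increasing \<open>\<lambda>\<close> keeps a point feasible and
  changes the objective continuously, so the infimum does not notice this.

  The shift is what makes the program geometric: \<open>c\<^sub>j\<close> is the least nonnegative number for which all
  the constants \<open>c\<^sub>j / N\<^sub>i ^ d - f\<^sub>d\<^sub>,\<^sub>i\<close> with \<open>i \<in> I\<^sub>j\<close> are nonnegative.  Hence each left-hand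
  side is a sum of monomial functions, possibly an empty one, and the empty sums are exactly the
  constraints that get dropped.  The right-hand sides \<open>(f\<^sub>\<alpha> / d) ^ d\<close> are positive because \<open>d\<close> is
  even.
\<close>

section \<open>Monomial functions and posynomials\<close>

lemma pos_orthantD: "x \<in> pos_orthant V \<Longrightarrow> v \<in> V \<Longrightarrow> 0 < x v"
  by (auto simp: pos_orthant_def PiE_iff)

lemma pos_orthant_nonempty: "\<exists>x. x \<in> pos_orthant V"
  by (rule exI[of _ "\<lambda>v\<in>V. 1"]) (auto simp: pos_orthant_def)

lemma monomial_function_cong:
  assumes "\<And>x. x \<in> pos_orthant V \<Longrightarrow> \<phi> x = \<psi> x"
  shows "monomial_function V \<phi> \<longleftrightarrow> monomial_function V \<psi>"
  using assms by (auto simp: monomial_function_def)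

lemma monomial_function_pos:
  assumes "monomial_function V \<phi>" "x \<in> pos_orthant V"
  shows "0 < \<phi> x"
proof -
  obtain c a where "c > 0" "\<phi> x = c * (\<Prod>v\<in>V. x v powr a v)"
    using assms by (auto simp: monomial_function_def)
  then show ?thesis
    using pos_orthantD[OF assms(2)] by (force intro!: mult_pos_pos prod_pos)
qed

lemma monomial_function_const:
  assumes "0 < c"
  shows "monomial_function V (\<lambda>x. c)"
proof -
  have "c = c * (\<Prod>v\<in>V. x v powr 0)" if x: "x \<in> pos_orthant V" for x
  proof -
    have "(\<Prod>v\<in>V. x v powr 0) = 1"
      using pos_orthantD[OF x] by (intro prod.neutral) fastforce
    then show ?thesis
      by simp
  qed
  with assms show ?thesis
    unfolding monomial_function_def by (intro exI[of _ c] exI[of _ "\<lambda>_. 0"] conjI) auto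
qed

lemma monomial_function_var:
  assumes "finite V" "v \<in> V"
  shows "monomial_function V (\<lambda>x. x v)"
proof -
  have "x v = 1 * (\<Prod>w\<in>V. x w powr (if w = v then 1 else 0))" if x: "x \<in> pos_orthant V" for x
  proof -
    have "(\<Prod>w\<in>V. x w powr (if w = v then 1 else 0)) = (\<Prod>w\<in>V. if w = v then x w else 1)"
    proof (intro prod.cong refl)
      fix w assume "w \<in> V"
      then have "0 < x w"
        by (rule pos_orthantD[OF x])
      then show "x w powr (if w = v then 1 else 0) = (if w = v then x w else 1)"
        by auto
    qed
    then show ?thesis
      using assms by simp
  qed
  then show ?thesis
    unfolding monomial_function_def by (intro exI[of _ 1] conjI exI ballI) auto
qed

lemma monomial_function_mult:
  assumes "monomial_function V \<phi>" "monomial_function V \<psi>"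
  shows "monomial_function V (\<lambda>x. \<phi> x * \<psi> x)"
proof -
  obtain c a where c: "c > 0" "\<And>x. x \<in> pos_orthant V \<Longrightarrow> \<phi> x = c * (\<Prod>v\<in>V. x v powr a v)"
    using assms(1) by (auto simp: monomial_function_def)
  obtain e b where e: "e > 0" "\<And>x. x \<in> pos_orthant V \<Longrightarrow> \<psi> x = e * (\<Prod>v\<in>V. x v powr b v)"
    using assms(2) by (auto simp: monomial_function_def)
  have "\<phi> x * \<psi> x = (c * e) * (\<Prod>v\<in>V. x v powr (a v + b v))" if "x \<in> pos_orthant V" for x
    using c(2)[OF that] e(2)[OF that] by (simp add: powr_add prod.distrib)
  then show ?thesis
    unfolding monomial_function_def using c(1) e(1)
    by (intro exI[of _ "c * e"] conjI exI[of _ "\<lambda>v. a v + b v"]) auto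
qed

lemma monomial_function_powr:
  assumes "monomial_function V \<phi>"
  shows "monomial_function V (\<lambda>x. \<phi> x powr r)"
proof -
  obtain c a where c: "c > 0" "\<And>x. x \<in> pos_orthant V \<Longrightarrow> \<phi> x = c * (\<Prod>v\<in>V. x v powr a v)"
    using assms by (auto simp: monomial_function_def)
  have "\<phi> x powr r = c powr r * (\<Prod>v\<in>V. x v powr (a v * r))" if "x \<in> pos_orthant V" for x
    using c(1) c(2)[OF that] by (simp add: powr_mult prod_nonneg prod_powr_distrib powr_powr)
  then show ?thesis
    unfolding monomial_function_def using c(1)
    by (intro exI[of _ "c powr r"] conjI exI[of _ "\<lambda>v. a v * r"]) auto
qed

lemma monomial_function_divide:
  assumes "monomial_function V \<phi>" "monomial_function V \<psi>"
  shows "monomial_function V (\<lambda>x. \<phi> x / \<psi> x)"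
proof -
  have "monomial_function V (\<lambda>x. \<phi> x * \<psi> x powr - 1)"
    by (intro monomial_function_mult monomial_function_powr assms)
  then show ?thesis
    using monomial_function_pos[OF assms(2)]
    by (subst monomial_function_cong) (auto simp: powr_minus_divide less_imp_le)
qed

lemma monomial_function_prod:
  assumes "\<And>a. a \<in> A \<Longrightarrow> monomial_function V (\<phi> a)"
  shows "monomial_function V (\<lambda>x. \<Prod>a\<in>A. \<phi> a x)"
  using assms
  by (induction A rule: infinite_finite_induct)
    (auto intro: monomial_function_const monomial_function_mult)

lemma monomial_function_power:
  "monomial_function V \<phi> \<Longrightarrow> monomial_function V (\<lambda>x. \<phi> x ^ k)"
  using monomial_function_prod[of "{..<k}" V "\<lambda>_. \<phi>"] by simp

text \<open>
  Allowing the empty sum makes the class closed under sums over arbitrary, possibly empty, index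
  sets, so that no case distinction is necessary before the final step.
\<close>

definition posynomial_or_zero :: "'v set \<Rightarrow> (('v \<Rightarrow> real) \<Rightarrow> real) \<Rightarrow> bool"
  where "posynomial_or_zero V \<phi> \<longleftrightarrow>
    (\<exists>(p :: nat) M. (\<forall>k<p. monomial_function V (M k)) \<and>
      (\<forall>x \<in> pos_orthant V. \<phi> x = (\<Sum>k<p. M k x)))"

lemma posynomial_if_not_zero:
  assumes "posynomial_or_zero V \<phi>" "\<not> (\<forall>x \<in> pos_orthant V. \<phi> x = 0)"
  shows "posynomial V \<phi>"
proof -
  obtain p :: nat and M where M: "\<forall>k<p. monomial_function V (M k)"
    "\<forall>x \<in> pos_orthant V. \<phi> x = (\<Sum>k<p. M k x)"
    using assms(1) by (auto simp: posynomial_or_zero_def)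
  have "p \<ge> 1"
    using M(2) assms(2) by (cases p) auto
  then show ?thesis
    using M by (auto simp: posynomial_def)
qed

lemma posynomial_or_zero_nonneg:
  assumes "posynomial_or_zero V \<phi>" "x \<in> pos_orthant V"
  shows "0 \<le> \<phi> x"
proof -
  obtain p :: nat and M where "\<forall>k<p. monomial_function V (M k)" "\<phi> x = (\<Sum>k<p. M k x)"
    using assms by (auto simp: posynomial_or_zero_def)
  then show ?thesis
    using monomial_function_pos[OF _ assms(2)] by (auto intro!: sum_nonneg intro: less_imp_le)
qed

lemma posynomial_or_zero_zero: "posynomial_or_zero V (\<lambda>x. 0)"
  unfolding posynomial_or_zero_def by (rule exI[of _ 0]) auto

lemma posynomial_or_zero_add_monomial:
  assumes "posynomial_or_zero V \<phi>" "monomial_function V \<psi>"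
  shows "posynomial_or_zero V (\<lambda>x. \<phi> x + \<psi> x)"
proof -
  obtain p :: nat and M where M: "\<forall>k<p. monomial_function V (M k)"
    "\<forall>x \<in> pos_orthant V. \<phi> x = (\<Sum>k<p. M k x)"
    using assms(1) by (auto simp: posynomial_or_zero_def)
  then show ?thesis
    unfolding posynomial_or_zero_def using assms(2)
    by (intro exI[of _ "Suc p"] exI[of _ "M(p := \<psi>)"]) (auto simp: less_Suc_eq)
qed

lemma posynomial_or_zero_monomial:
  "monomial_function V \<psi> \<Longrightarrow> posynomial_or_zero V \<psi>"
  using posynomial_or_zero_add_monomial[OF posynomial_or_zero_zero] by simp

lemma posynomial_or_zero_const: "0 \<le> c \<Longrightarrow> posynomial_or_zero V (\<lambda>x. c)"
  by (auto simp: le_less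
      intro: posynomial_or_zero_zero posynomial_or_zero_monomial monomial_function_const)

lemma posynomial_or_zero_add:
  assumes "posynomial_or_zero V \<phi>" "posynomial_or_zero V \<psi>"
  shows "posynomial_or_zero V (\<lambda>x. \<phi> x + \<psi> x)"
proof -
  obtain p :: nat and M where M: "\<forall>k<p. monomial_function V (M k)"
    "\<forall>x \<in> pos_orthant V. \<psi> x = (\<Sum>k<p. M k x)"
    using assms(2) by (auto simp: posynomial_or_zero_def)
  have "q \<le> p \<Longrightarrow> posynomial_or_zero V (\<lambda>x. \<phi> x + (\<Sum>k<q. M k x))" for q
  proof (induction q)
    case (Suc q)
    then have "posynomial_or_zero V (\<lambda>x. \<phi> x + (\<Sum>k<q. M k x))" "monomial_function V (M q)"
      using M(1) by auto
    then have "posynomial_or_zero V (\<lambda>x. (\<phi> x + (\<Sum>k<q. M k x)) + M q x)"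
      by (rule posynomial_or_zero_add_monomial)
    then show ?case
      by (simp add: add.assoc)
  qed (use assms(1) in simp)
  from this[of p] M(2) show ?thesis
    by (auto simp: posynomial_or_zero_def)
qed

lemma posynomial_or_zero_sum:
  assumes "\<And>a. a \<in> A \<Longrightarrow> posynomial_or_zero V (\<phi> a)"
  shows "posynomial_or_zero V (\<lambda>x. \<Sum>a\<in>A. \<phi> a x)"
  using assms
  by (induction A rule: infinite_finite_induct)
    (auto intro: posynomial_or_zero_zero posynomial_or_zero_add)

lemma posynomial_or_zero_divide:
  assumes "posynomial_or_zero V \<phi>" "monomial_function V \<psi>"
  shows "posynomial_or_zero V (\<lambda>x. \<phi> x / \<psi> x)"
proof -
  obtain p :: nat and M where M: "\<forall>k<p. monomial_function V (M k)"
    "\<forall>x \<in> pos_orthant V. \<phi> x = (\<Sum>k<p. M k x)"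
    using assms(1) by (auto simp: posynomial_or_zero_def)
  then show ?thesis
    unfolding posynomial_or_zero_def using assms(2)
    by (intro exI[of _ p] exI[of _ "\<lambda>k x. M k x / \<psi> x"])
      (auto simp: sum_divide_distrib intro: monomial_function_divide)
qed


section \<open>Coefficients of the Lagrangian\<close>

lemma finite_Delta: "finite (Delta d h)"
proof (rule finite_subset)
  show "Delta d h \<subseteq> Poly_Mapping.keys h"
    by (auto simp: Delta_def Omega_def in_keys_iff)
qed simp

lemma axis_eq_0_iff: "axis i (k :: nat) = 0 \<longleftrightarrow> k = 0"
  by (auto simp: axis_def vec_eq_iff)

lemma single_axis_power:
  "Poly_Mapping.single (axis i 1) (a :: real) ^ k = Poly_Mapping.single (axis i k) (a ^ k)"
proof (induction k)
  case 0
  show ?case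
    by (metis axis_eq_0_iff power_0 single_one)
next
  case (Suc k)
  have "axis i 1 + axis i k = axis i (Suc k)"
    by (simp add: axis_def vec_eq_iff)
  with Suc show ?case
    by (simp add: mult_single)
qed

text \<open>The polynomials \<open>g\<^sub>j\<close> cut out weighted \<open>d\<close>-norm balls in the variables of one block.\<close>

lemma mult_ball_polynomial:
  fixes N :: "'n::finite \<Rightarrow> real"
  shows "Const l * (1 - (\<Sum>i\<in>J. (Const (1 / N i) * Var i) ^ d))
    = Const l - (\<Sum>i\<in>J. Poly_Mapping.single (axis i d) (l / N i ^ d))"
proof -
  have "(Const (1 / N i) * Var i) ^ d = Poly_Mapping.single (axis i d) ((1 / N i) ^ d)" for i
    unfolding Const_def Var_def mult_single by (simp add: single_axis_power del: One_nat_def)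
  then show ?thesis
    by (simp add: right_diff_distrib sum_distrib_left Const_def mult_single power_one_over)
qed

locale ball_partition =
  fixes f :: "'n::finite rpoly" and d :: nat and N :: "'n \<Rightarrow> real"
    and I :: "'m::finite \<Rightarrow> 'n set" and g :: "'m \<Rightarrow> 'n rpoly" and c :: "'m \<Rightarrow> real"
  assumes d_even: "even d" and d_ge_2: "2 \<le> d"
    and N_pos: "\<And>i. 0 < N i"
    and inj_I: "inj I" and partition_I: "partition_on UNIV (range I)"
    and g_eq: "\<And>j. g j = 1 - (\<Sum>i\<in>I j. (Const (1 / N i) * Var i) ^ d)"
    and c_eq: "\<And>j. c j = Max ({mcoeff f (axis i d) * N i ^ d | i. i \<in> I j} \<union> {0})"
begin

lemma block_unique:
  assumes "i \<in> I j" "i \<in> I k"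
  shows "k = j"
proof -
  have "I k = I j"
    using partition_onD2[OF partition_I] assms by (meson disjointD disjoint_iff rangeI)
  then show ?thesis
    using inj_I by (simp add: inj_eq)
qed

lemma block_exists: "\<exists>j. i \<in> I j"
  using partition_I by (auto simp: partition_on_def)

definition lagrangian :: "real ^ 'm \<Rightarrow> 'n rpoly"
  where "lagrangian l = f - (\<Sum>j\<in>UNIV. Const (l $ j) * g j)"

lemma lookup_lagrangian:
  "mcoeff (lagrangian l) \<alpha> = mcoeff f \<alpha> - (\<Sum>j\<in>UNIV. (l $ j when \<alpha> = 0)
    - (\<Sum>i\<in>I j. (l $ j / N i ^ d when axis i d = \<alpha>)))"
  unfolding lagrangian_def g_eq mult_ball_polynomial
  by (simp add: lookup_minus lookup_sum lookup_single Const_def when_def eq_commute[of 0])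

lemma lookup_lagrangian_zero: "mcoeff (lagrangian l) 0 = mcoeff f 0 - (\<Sum>j\<in>UNIV. l $ j)"
  using d_ge_2 by (simp add: lookup_lagrangian axis_eq_0_iff)

text \<open>
  The blocks are disjoint, so exactly one multiplier contributes to the coefficient of \<open>x\<^sub>i ^ d\<close>.
\<close>

lemma lookup_lagrangian_axis:
  assumes "i \<in> I j"
  shows "mcoeff (lagrangian l) (axis i d) = mcoeff f (axis i d) + l $ j / N i ^ d"
proof -
  have "(\<Sum>i'\<in>I k. (l $ k / N i' ^ d when axis i' d = axis i d))
      = (if k = j then l $ j / N i ^ d else 0)" for k
  proof -
    have "(\<Sum>i'\<in>I k. (l $ k / N i' ^ d when axis i' d = axis i d))
        = (\<Sum>i'\<in>I k. if i' = i then l $ k / N i ^ d else 0)"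
      using d_ge_2 by (intro sum.cong) (auto simp: axis_eq_axis when_def)
    also have "\<dots> = (if k = j then l $ j / N i ^ d else 0)"
    proof (cases "k = j")
      case True
      then show ?thesis
        using assms by simp
    next
      case False
      then have "i \<notin> I k"
        using assms block_unique[of i j k] by blast
      with False show ?thesis
        by simp
    qed
    finally show ?thesis .
  qed
  then show ?thesis
    using d_ge_2 by (simp add: lookup_lagrangian axis_eq_0_iff sum_negf)
qed

lemma lookup_lagrangian_other:
  assumes "\<alpha> \<notin> insert 0 (range (\<lambda>i. axis i d))"
  shows "mcoeff (lagrangian l) \<alpha> = mcoeff f \<alpha>"
proof -
  have "axis i d \<noteq> \<alpha>" for i
    using assms by auto
  with assms show ?thesis
    by (simp add: lookup_lagrangian)
qed

lemma Omega_lagrangian: "Omega d (lagrangian l) = Omega d f"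
proof (rule set_eqI)
  fix \<alpha>
  show "\<alpha> \<in> Omega d (lagrangian l) \<longleftrightarrow> \<alpha> \<in> Omega d f"
  proof (cases "\<alpha> \<in> insert 0 (range (\<lambda>i. axis i d))")
    case True
    then show ?thesis
      by (simp add: Omega_def)
  next
    case False
    then show ?thesis
      by (simp add: Omega_def lookup_lagrangian_other)
  qed
qed

lemma lookup_lagrangian_Delta: "\<alpha> \<in> Delta d f \<Longrightarrow> mcoeff (lagrangian l) \<alpha> = mcoeff f \<alpha>"
  by (intro lookup_lagrangian_other) (auto simp: Delta_def Omega_def)

lemma Delta_lagrangian: "Delta d (lagrangian l) = Delta d f"
proof -
  have "mcoeff (lagrangian l) \<alpha> = mcoeff f \<alpha>" if "\<alpha> \<in> Omega d f" for \<alpha>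
    using that by (intro lookup_lagrangian_other) (auto simp: Omega_def)
  then show ?thesis
    unfolding Delta_def Omega_lagrangian by auto
qed

lemma gp_objective_lagrangian: "gp_objective d (lagrangian l) = gp_objective d f"
proof
  fix z
  show "gp_objective d (lagrangian l) z = gp_objective d f z"
    unfolding gp_objective_def Delta_less_def Delta_lagrangian
    by (rule sum.cong) (simp_all add: lookup_lagrangian_Delta)
qed


section \<open>The supremum over the multipliers\<close>

text \<open>
  The sets of constraints are given as families of pairs of functions; these two rules turn a
  quantifier over such a family into a quantifier over its index.
\<close>

lemma ball_pair_family:
  "(\<forall>(l, r) \<in> {(L a, R a) | a. P a}. Q l r) \<longleftrightarrow> (\<forall>a. P a \<longrightarrow> Q (L a) (R a))"
  by blast

lemma ball_pair_family2:
  "(\<forall>(l, r) \<in> {(L a b, R a b) | a b. P a b}. Q l r) \<longleftrightarrow> (\<forall>a b. P a b \<longrightarrow> Q (L a b) (R a b))"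
  by blast

lemma feasible_rho_iff:
  "z \<in> feasible (rho_program d h) \<longleftrightarrow>
    z \<in> z_families (Delta d h) \<and>
    (\<forall>i. (\<Sum>\<alpha>\<in>Delta d h. z \<alpha> $ i) \<le> mcoeff h (axis i d)) \<and>
    (\<forall>\<alpha>\<in>Delta_eq d h. over_exp (z \<alpha>) \<alpha> = (mcoeff h \<alpha> / real d) ^ d)"
  unfolding feasible_def rho_program_def program.simps mem_Collect_eq ball_pair_family
  by blast

lemma feasible_lagrangian_iff:
  "z \<in> feasible (rho_program d (lagrangian l)) \<longleftrightarrow>
    z \<in> z_families (Delta d f) \<and>
    (\<forall>j. \<forall>i\<in>I j. (\<Sum>\<alpha>\<in>Delta d f. z \<alpha> $ i) \<le> mcoeff f (axis i d) + l $ j / N i ^ d) \<and>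
    (\<forall>\<alpha>\<in>Delta_eq d f. over_exp (z \<alpha>) \<alpha> = (mcoeff f \<alpha> / real d) ^ d)"
proof -
  have "(\<forall>i. (\<Sum>\<alpha>\<in>Delta d f. z \<alpha> $ i) \<le> mcoeff (lagrangian l) (axis i d)) \<longleftrightarrow>
    (\<forall>j. \<forall>i\<in>I j. (\<Sum>\<alpha>\<in>Delta d f. z \<alpha> $ i) \<le> mcoeff (lagrangian l) (axis i d))"
    using block_exists by blast
  also have "\<dots> \<longleftrightarrow>
    (\<forall>j. \<forall>i\<in>I j. (\<Sum>\<alpha>\<in>Delta d f. z \<alpha> $ i) \<le> mcoeff f (axis i d) + l $ j / N i ^ d)"
    by (simp add: lookup_lagrangian_axis)
  finally have "(\<forall>i. (\<Sum>\<alpha>\<in>Delta d f. z \<alpha> $ i) \<le> mcoeff (lagrangian l) (axis i d)) \<longleftrightarrow>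
    (\<forall>j. \<forall>i\<in>I j. (\<Sum>\<alpha>\<in>Delta d f. z \<alpha> $ i) \<le> mcoeff f (axis i d) + l $ j / N i ^ d)" .
  moreover have "Delta_eq d (lagrangian l) = Delta_eq d f"
    by (simp add: Delta_eq_def Delta_lagrangian)
  moreover have "mcoeff (lagrangian l) \<alpha> = mcoeff f \<alpha>" if "\<alpha> \<in> Delta_eq d f" for \<alpha>
    using that by (simp add: Delta_eq_def lookup_lagrangian_Delta)
  ultimately show ?thesis
    by (simp add: feasible_rho_iff Delta_lagrangian)
qed

lemma feasible_partition_iff:
  "(z, \<mu>) \<in> feasible (partition_program d f N I c) \<longleftrightarrow>
    z \<in> z_families (Delta d f) \<and> (\<forall>j. 0 < \<mu> $ j) \<and>
    (\<forall>j. \<forall>i\<in>I j. (\<Sum>\<alpha>\<in>Delta d f. z \<alpha> $ i) + (c j / N i ^ d - mcoeff f (axis i d))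
      \<le> \<mu> $ j / N i ^ d) \<and>
    (\<forall>j. c j \<le> \<mu> $ j) \<and>
    (\<forall>\<alpha>\<in>Delta_eq d f. over_exp (z \<alpha>) \<alpha> = (mcoeff f \<alpha> / real d) ^ d)"
  unfolding feasible_def partition_program_def program.simps mem_Collect_eq ball_Un
    ball_pair_family ball_pair_family2 prod.case mem_Times_iff fst_conv snd_conv
  by blast

text \<open>
  Adding \<open>c\<^sub>j\<close> to the multiplier cancels the term \<open>c\<^sub>j / N\<^sub>i ^ d\<close> on both sides of each row.  The
  positivity hypothesis makes \<open>\<mu> = \<lambda> + c\<close> an admissible vector; it does not follow from
  \<open>\<lambda> \<ge> 0\<close> when some \<open>c\<^sub>j\<close> is 0.
\<close>

lemma feasible_shift_iff:
  assumes "\<And>j. 0 < l $ j + c j"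
  shows "(z, \<chi> j. l $ j + c j) \<in> feasible (partition_program d f N I c) \<longleftrightarrow>
    (\<forall>j. 0 \<le> l $ j) \<and> z \<in> feasible (rho_program d (lagrangian l))"
proof -
  have row: "s + (c j / N i ^ d - a) \<le> (l $ j + c j) / N i ^ d \<longleftrightarrow> s \<le> a + l $ j / N i ^ d"
    for s a i j
    by (simp add: add_divide_distrib algebra_simps)
  show ?thesis
    unfolding feasible_lagrangian_iff feasible_partition_iff vec_lambda_beta row
      le_add_same_cancel2
    using assms by blast
qed

text \<open>
  Larger multipliers only relax the rows.  This is what allows replacing \<open>\<lambda>\<close> by a strictly
  positive vector arbitrarily close to it.
\<close>

lemma feasible_lagrangian_mono:
  assumes "z \<in> feasible (rho_program d (lagrangian l))" "\<And>j. l $ j \<le> l' $ j"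
  shows "z \<in> feasible (rho_program d (lagrangian l'))"
proof -
  have "mcoeff f (axis i d) + l $ j / N i ^ d \<le> mcoeff f (axis i d) + l' $ j / N i ^ d" for i j
    using assms(2) N_pos[of i] by (intro add_left_mono divide_right_mono) (auto simp: less_imp_le)
  moreover have "(\<Sum>\<alpha>\<in>Delta d f. z \<alpha> $ i) \<le> mcoeff f (axis i d) + l $ j / N i ^ d"
    if "i \<in> I j" for i j
    using assms(1) that unfolding feasible_lagrangian_iff by blast
  ultimately have "\<forall>j. \<forall>i\<in>I j.
      (\<Sum>\<alpha>\<in>Delta d f. z \<alpha> $ i) \<le> mcoeff f (axis i d) + l' $ j / N i ^ d"
    by (meson order_trans)
  then show ?thesis
    using assms(1) unfolding feasible_lagrangian_iff by blast
qed

end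

text \<open>
  Rewriting a bound as a supremum lets nested optimizations be compared value by value.  For an
  infeasible program both sides are \<open>-\<infinity>\<close>.
\<close>

lemma ereal_minus_INF:
  "ereal x - (INF a\<in>A. ereal (h a)) = (SUP a\<in>A. ereal (x - h a))"
proof (cases "A = {}")
  case True
  then show ?thesis
    by (simp add: top_ereal_def bot_ereal_def)
next
  case False
  then show ?thesis
    using SUP_ereal_minus_right[of A "ereal x" "\<lambda>a. ereal (h a)", symmetric]
    by (simp only: ereal_minus(1)) simp
qed

context ball_partition
begin

lemma gp_bound_lagrangian:
  "gp_bound d (lagrangian l) = (SUP z \<in> feasible (rho_program d (lagrangian l)).
    ereal (mcoeff f 0 - (\<Sum>j\<in>UNIV. l $ j) - gp_objective d f z))"
proof -
  have "objective (rho_program d (lagrangian l)) = gp_objective d f"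
    by (simp add: rho_program_def gp_objective_lagrangian)
  then show ?thesis
    by (simp only: gp_bound_def optimum_value_def ereal_minus_INF lookup_lagrangian_zero)
qed

lemma c_nonneg: "0 \<le> c j"
  unfolding c_eq by (rule Max_ge) auto

text \<open>
  The choice of \<open>c\<close> makes the constants \<open>c\<^sub>j / N\<^sub>i ^ d - f\<^sub>d\<^sub>,\<^sub>i\<close> of the rows nonnegative, so that they
  are admissible terms of a posynomial.
\<close>

lemma coeff_le_c:
  assumes "i \<in> I j"
  shows "mcoeff f (axis i d) \<le> c j / N i ^ d"
proof -
  have "mcoeff f (axis i d) * N i ^ d \<le> c j"
    unfolding c_eq using assms by (intro Max_ge) auto
  then show ?thesis
    using N_pos[of i] by (simp add: pos_le_divide_eq)
qed

text \<open>
  Both sides are suprema of the same values, one over pairs \<open>(\<lambda>, z)\<close> and one over pairs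
  \<open>(z, \<mu>)\<close>.  Every \<open>(z, \<mu>)\<close> comes from \<open>\<lambda> = \<mu> - c\<close>; in the other direction \<open>\<lambda>\<close> is first raised,
  at arbitrarily small cost.
\<close>

lemma s_bound_eq:
  "s_bound d f g
    = ereal (mcoeff f 0 + (\<Sum>j\<in>UNIV. c j)) - optimum_value (partition_program d f N I c)"
proof -
  let ?P = "feasible (partition_program d f N I c)"
  let ?R = "\<lambda>l. feasible (rho_program d (lagrangian l))"
  let ?v = "\<lambda>l z. mcoeff f 0 - (\<Sum>j\<in>UNIV. l $ j) - gp_objective d f z"
  let ?w = "\<lambda>p. mcoeff f 0 + (\<Sum>j\<in>UNIV. c j) - objective (partition_program d f N I c) p"
  have objective_shift: "?w (z, \<chi> j. l $ j + c j) = ?v l z" for z l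
    by (simp add: partition_program_def sum.distrib)
  have "(SUP l \<in> {l. \<forall>j. 0 \<le> l $ j}. SUP z \<in> ?R l. ereal (?v l z)) = (SUP p \<in> ?P. ereal (?w p))"
    (is "?L = ?M")
  proof (rule antisym)
    show "?L \<le> ?M"
    proof (intro SUP_least, rule ereal_le_epsilon2)
      fix l :: "real ^ 'm" and z and e :: real
      assume l: "l \<in> {l. \<forall>j. 0 \<le> l $ j}" and z: "z \<in> ?R l" and "0 < e"
      \<comment> \<open>The share \<open>e / CARD('m)\<close> makes the total increase exactly \<open>e\<close>, and \<open>\<mu>\<close> becomes positive.\<close>
      define l' :: "real ^ 'm" where "l' = (\<chi> j. l $ j + e / CARD('m))"
      have l'_pos: "0 < l' $ j" for j
        using l \<open>0 < e\<close> by (auto simp: l'_def intro!: add_nonneg_pos)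
      have "z \<in> ?R l'"
        using \<open>0 < e\<close> by (intro feasible_lagrangian_mono[OF z]) (auto simp: l'_def)
      then have "(z, \<chi> j. l' $ j + c j) \<in> ?P"
        using l'_pos c_nonneg
        by (subst feasible_shift_iff) (auto intro: less_imp_le add_pos_nonneg)
      then have "ereal (?v l' z) \<le> ?M"
        unfolding objective_shift[symmetric] by (rule SUP_upper)
      moreover have "?v l z = ?v l' z + e"
        by (simp add: l'_def sum.distrib)
      ultimately show "ereal (?v l z) \<le> ?M + ereal e"
        by (metis add_right_mono plus_ereal.simps(1))
    qed
    show "?M \<le> ?L"
    proof (rule SUP_least)
      fix p assume p: "p \<in> ?P"
      obtain z \<mu> where p_eq: "p = (z, \<mu>)"
        by (cases p)
      define l where "l = (\<chi> j. \<mu> $ j - c j)"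
      have \<mu>_eq: "\<mu> = (\<chi> j. l $ j + c j)"
        by (simp add: l_def vec_eq_iff)
      have "0 < l $ j + c j" for j
        using p by (simp add: p_eq l_def feasible_partition_iff)
      then have "\<forall>j. 0 \<le> l $ j" "z \<in> ?R l"
        using p feasible_shift_iff[of l z] unfolding p_eq \<mu>_eq by auto
      moreover have "ereal (?w p) = ereal (?v l z)"
        unfolding p_eq \<mu>_eq objective_shift ..
      ultimately show "ereal (?w p) \<le> ?L"
        by (auto intro!: SUP_upper2[of l] SUP_upper2[of z])
    qed
  qed
  then show ?thesis
    unfolding optimum_value_def ereal_minus_INF s_bound_def lagrangian_def[symmetric]
      gp_bound_lagrangian .
qed


section \<open>The program is geometric\<close>

abbreviation vars :: "((nat ^ 'n) \<times> 'n + 'm) set"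
  where "vars \<equiv> positive_vars d f"

abbreviation param ::
    "((nat ^ 'n) \<times> 'n + 'm \<Rightarrow> real) \<Rightarrow> (nat ^ 'n \<Rightarrow> real ^ 'n) \<times> (real ^ 'm)"
  where "param \<equiv> from_positive_vars d f"

lemma finite_vars: "finite vars"
proof -
  have "finite {(\<alpha>, i). \<alpha> \<in> Delta d f \<and> \<alpha> $ i \<noteq> 0}"
    by (rule finite_subset[of _ "Delta d f \<times> UNIV"]) (auto simp: finite_Delta)
  then show ?thesis
    by (simp add: positive_vars_def)
qed

lemma Inl_vars_iff: "Inl (\<alpha>, i) \<in> vars \<longleftrightarrow> \<alpha> \<in> Delta d f \<and> \<alpha> $ i \<noteq> 0"
  by (auto simp: positive_vars_def)

lemma Inr_vars: "Inr j \<in> vars"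
  by (auto simp: positive_vars_def)

lemma bij_betw_param:
  "bij_betw param (pos_orthant vars) (z_families (Delta d f) \<times> {\<mu>. \<forall>j. 0 < \<mu> $ j})"
proof (rule bij_betw_byWitness[where
      f' = "\<lambda>(z, \<mu>). \<lambda>v\<in>vars. case v of Inl (\<alpha>, i) \<Rightarrow> z \<alpha> $ i | Inr j \<Rightarrow> \<mu> $ j"])
  show "\<forall>x\<in>pos_orthant vars.
      (case param x of (z, \<mu>) \<Rightarrow> \<lambda>v\<in>vars. case v of Inl (\<alpha>, i) \<Rightarrow> z \<alpha> $ i | Inr j \<Rightarrow> \<mu> $ j) = x"
  proof
    fix x assume x: "x \<in> pos_orthant vars"
    have "x v = undefined" if "v \<notin> vars" for v
      using x that by (auto simp: pos_orthant_def PiE_iff extensional_def)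
    then show "(case param x of (z, \<mu>) \<Rightarrow>
        \<lambda>v\<in>vars. case v of Inl (\<alpha>, i) \<Rightarrow> z \<alpha> $ i | Inr j \<Rightarrow> \<mu> $ j) = x"
      by (auto simp: from_positive_vars_def fun_eq_iff Inl_vars_iff split: sum.split)
  qed
  show "\<forall>p\<in>z_families (Delta d f) \<times> {\<mu>. \<forall>j. 0 < \<mu> $ j}. param
      (case p of (z, \<mu>) \<Rightarrow> \<lambda>v\<in>vars. case v of Inl (\<alpha>, i) \<Rightarrow> z \<alpha> $ i | Inr j \<Rightarrow> \<mu> $ j) = p"
  proof (clarify)
    fix z \<mu> assume z: "z \<in> z_families (Delta d f)"
    have "z \<alpha> = undefined" if "\<alpha> \<notin> Delta d f" for \<alpha>
      using z that by (auto simp: z_families_def PiE_iff extensional_def)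
    moreover have "z \<alpha> $ i = 0 \<longleftrightarrow> \<alpha> $ i = 0" if "\<alpha> \<in> Delta d f" for \<alpha> i
      using z that by (auto simp: z_families_def PiE_iff)
    ultimately show "param (\<lambda>v\<in>vars. case v of Inl (\<alpha>, i) \<Rightarrow> z \<alpha> $ i | Inr j \<Rightarrow> \<mu> $ j) = (z, \<mu>)"
      by (auto simp: from_positive_vars_def fun_eq_iff vec_eq_iff Inl_vars_iff Inr_vars)
  qed
  show "param ` pos_orthant vars \<subseteq> z_families (Delta d f) \<times> {\<mu>. \<forall>j. 0 < \<mu> $ j}"
  proof (rule image_subsetI)
    fix x assume x: "x \<in> pos_orthant vars"
    have "0 \<le> (if \<alpha> $ i = 0 then 0 else x (Inl (\<alpha>, i))) \<and>
        ((if \<alpha> $ i = 0 then 0 else x (Inl (\<alpha>, i))) = 0 \<longleftrightarrow> \<alpha> $ i = 0)"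
      if "\<alpha> \<in> Delta d f" for \<alpha> i
      using pos_orthantD[OF x, of "Inl (\<alpha>, i)"] that by (auto simp: Inl_vars_iff)
    moreover have "0 < x (Inr j)" for j
      using pos_orthantD[OF x Inr_vars] .
    ultimately show "param x \<in> z_families (Delta d f) \<times> {\<mu>. \<forall>j. 0 < \<mu> $ j}"
      by (simp add: from_positive_vars_def z_families_def)
  qed
  show "(\<lambda>(z, \<mu>). \<lambda>v\<in>vars. case v of Inl (\<alpha>, i) \<Rightarrow> z \<alpha> $ i | Inr j \<Rightarrow> \<mu> $ j) `
      (z_families (Delta d f) \<times> {\<mu>. \<forall>j. 0 < \<mu> $ j}) \<subseteq> pos_orthant vars"
  proof (clarify)
    fix z and \<mu> :: "real ^ 'm"
    assume z: "z \<in> z_families (Delta d f)" and \<mu>: "\<forall>j. 0 < \<mu> $ j"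
    have "0 < z \<alpha> $ i" if "\<alpha> \<in> Delta d f" "\<alpha> $ i \<noteq> 0" for \<alpha> i
    proof -
      have "0 \<le> z \<alpha> $ i" "z \<alpha> $ i \<noteq> 0"
        using z that by (auto simp: z_families_def PiE_iff)
      then show ?thesis
        by linarith
    qed
    with \<mu> show "(\<lambda>v\<in>vars. case v of Inl (\<alpha>, i) \<Rightarrow> z \<alpha> $ i | Inr j \<Rightarrow> \<mu> $ j) \<in> pos_orthant vars"
      by (auto simp: pos_orthant_def Inl_vars_iff split: sum.split)
  qed
qed

lemma monomial_mu: "monomial_function vars (\<lambda>x. snd (param x) $ j)"
  using monomial_function_var[OF finite_vars Inr_vars] by (simp add: from_positive_vars_def)

lemma monomial_z:
  assumes "\<alpha> \<in> Delta d f" "\<alpha> $ i \<noteq> 0"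
  shows "monomial_function vars (\<lambda>x. fst (param x) \<alpha> $ i)"
  using monomial_function_var[OF finite_vars, of "Inl (\<alpha>, i)"] assms
  by (simp add: from_positive_vars_def Inl_vars_iff)

text \<open>A vanishing \<open>z\<^sub>\<alpha>\<^sub>i\<close> is not a monomial function, hence the empty sum has to be admitted here.\<close>

lemma posynomial_or_zero_z:
  assumes "\<alpha> \<in> Delta d f"
  shows "posynomial_or_zero vars (\<lambda>x. fst (param x) \<alpha> $ i)"
proof (cases "\<alpha> $ i = 0")
  case True
  then show ?thesis
    using assms posynomial_or_zero_zero by (simp add: from_positive_vars_def)
next
  case False
  then show ?thesis
    by (intro posynomial_or_zero_monomial monomial_z assms)
qed

lemma monomial_exp_over:
  assumes "\<alpha> \<in> Delta d f"
  shows "monomial_function vars (\<lambda>x. exp_over \<alpha> (fst (param x) \<alpha>))"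
  unfolding exp_over_def
proof (rule monomial_function_prod)
  fix i
  show "monomial_function vars
      (\<lambda>x. real (\<alpha> $ i) ^ (\<alpha> $ i) / (fst (param x) \<alpha> $ i) ^ (\<alpha> $ i))"
  proof (cases "\<alpha> $ i = 0")
    case False
    then show ?thesis
      using assms by (intro monomial_function_divide monomial_function_power
          monomial_function_const monomial_z) auto
  qed (simp add: monomial_function_const)
qed

lemma monomial_over_exp:
  assumes "\<alpha> \<in> Delta d f"
  shows "monomial_function vars (\<lambda>x. over_exp (fst (param x) \<alpha>) \<alpha>)"
  unfolding over_exp_def
proof (rule monomial_function_prod)
  fix i
  show "monomial_function vars
      (\<lambda>x. (fst (param x) \<alpha> $ i) ^ (\<alpha> $ i) / real (\<alpha> $ i) ^ (\<alpha> $ i))"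
  proof (cases "\<alpha> $ i = 0")
    case False
    then show ?thesis
      using assms by (intro monomial_function_divide monomial_function_power
          monomial_function_const monomial_z) auto
  qed (simp add: monomial_function_const)
qed

lemma scaled_coeff_power_pos:
  assumes "\<alpha> \<in> Delta d f"
  shows "0 < (mcoeff f \<alpha> / real d) ^ d"
  using assms d_even d_ge_2 by (auto simp: Delta_def Omega_def zero_less_power_eq)

lemma posynomial_or_zero_gp_objective:
  "posynomial_or_zero vars (\<lambda>x. gp_objective d f (fst (param x)))"
  unfolding gp_objective_def
proof (intro posynomial_or_zero_sum posynomial_or_zero_monomial monomial_function_mult
    monomial_function_powr)
  fix \<alpha> assume "\<alpha> \<in> Delta_less d f"
  then have "\<alpha> \<in> Delta d f" "size_exp \<alpha> < d"
    by (auto simp: Delta_less_def)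
  then show "monomial_function vars (\<lambda>x. real d - real (size_exp \<alpha>))"
    and "monomial_function vars (\<lambda>x. (mcoeff f \<alpha> / real d) ^ d)"
    and "monomial_function vars (\<lambda>x. exp_over \<alpha> (fst (param x) \<alpha>))"
    by (auto intro: monomial_function_const monomial_exp_over scaled_coeff_power_pos)
qed

text \<open>
  There is at least one summand \<open>\<mu>\<^sub>j\<close>, so the objective is positive and not an empty sum even if
  \<open>\<Delta>(f)\<close> is empty.
\<close>

lemma posynomial_objective:
  "posynomial vars (\<lambda>x. objective (partition_program d f N I c) (param x))"
proof (rule posynomial_if_not_zero)
  show "posynomial_or_zero vars (\<lambda>x. objective (partition_program d f N I c) (param x))"
    by (simp add: partition_program_def case_prod_beta posynomial_or_zero_add
        posynomial_or_zero_sum posynomial_or_zero_monomial monomial_mu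
        posynomial_or_zero_gp_objective)
  obtain x where x: "x \<in> pos_orthant vars"
    using pos_orthant_nonempty by blast
  have "0 < (\<Sum>j\<in>UNIV. snd (param x) $ j) + gp_objective d f (fst (param x))"
    using monomial_function_pos[OF monomial_mu x]
      posynomial_or_zero_nonneg[OF posynomial_or_zero_gp_objective x]
    by (intro add_pos_nonneg sum_pos) auto
  then have "objective (partition_program d f N I c) (param x) \<noteq> 0"
    by (simp add: partition_program_def case_prod_beta)
  then show "\<not> (\<forall>x\<in>pos_orthant vars. objective (partition_program d f N I c) (param x) = 0)"
    using x by blast
qed

lemma le_constraints_monomial:
  assumes "(l, r) \<in> le_constraints (partition_program d f N I c)"
  shows "posynomial_or_zero vars (\<lambda>x. l (param x))" "monomial_function vars (\<lambda>x. r (param x))"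
proof -
  consider i j where "i \<in> I j"
      "l = (\<lambda>(z, \<mu>). (\<Sum>\<alpha>\<in>Delta d f. z \<alpha> $ i) + (c j / N i ^ d - mcoeff f (axis i d)))"
      "r = (\<lambda>(z, \<mu>). \<mu> $ j / N i ^ d)"
    | j where "l = (\<lambda>(z, \<mu>). c j)" "r = (\<lambda>(z, \<mu>). \<mu> $ j)"
    using assms unfolding partition_program_def by auto
  then show "posynomial_or_zero vars (\<lambda>x. l (param x))"
  proof cases
    case 1
    then show ?thesis
      using coeff_le_c[OF 1(1)]
      by (auto simp: case_prod_beta intro!: posynomial_or_zero_add posynomial_or_zero_sum
          posynomial_or_zero_z posynomial_or_zero_const[where c = "_ - _"])
  qed (simp add: case_prod_beta posynomial_or_zero_const c_nonneg)
  show "monomial_function vars (\<lambda>x. r (param x))"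
    using assms N_pos by (auto simp: partition_program_def case_prod_beta
        intro!: monomial_mu monomial_function_divide monomial_function_const)
qed

lemma eq_constraints_monomial:
  assumes "(l, r) \<in> eq_constraints (partition_program d f N I c)"
  shows "monomial_function vars (\<lambda>x. l (param x))" "monomial_function vars (\<lambda>x. r (param x))"
proof -
  obtain \<alpha> where "\<alpha> \<in> Delta_eq d f" and lr: "l = (\<lambda>(z, \<mu>). over_exp (z \<alpha>) \<alpha>)"
      "r = (\<lambda>(z, \<mu>). (mcoeff f \<alpha> / real d) ^ d)"
    using assms unfolding partition_program_def by auto
  then have "\<alpha> \<in> Delta d f"
    by (simp add: Delta_eq_def)
  then show "monomial_function vars (\<lambda>x. l (param x))" "monomial_function vars (\<lambda>x. r (param x))"
    by (simp_all add: lr case_prod_beta monomial_over_exp monomial_function_const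
        scaled_coeff_power_pos)
qed

lemma finite_family2:
  fixes F :: "'a::finite \<Rightarrow> 'b::finite \<Rightarrow> 'c"
  shows "finite {F a b | a b. P a b}"
  by (rule finite_subset[of _ "range (\<lambda>(a, b). F a b)"]) auto

lemma finite_constraints:
  "finite (le_constraints (partition_program d f N I c))"
  "finite (eq_constraints (partition_program d f N I c))"
proof -
  show "finite (le_constraints (partition_program d f N I c))"
    unfolding partition_program_def by (simp add: finite_family2 full_SetCompr_eq)
  show "finite (eq_constraints (partition_program d f N I c))"
    by (simp add: partition_program_def Delta_eq_def finite_Delta)
qed

text \<open>
  A left-hand side that remains after dropping the trivial constraints is an honest posynomial, by
  \<open>posynomial_if_not_zero\<close>.
\<close>

lemma geometric: "is_geometric_program vars param (partition_program d f N I c)"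
proof -
  let ?P = "partition_program d f N I c"
  let ?div = "\<lambda>(l, r). (\<lambda>x. l (param x) / r (param x), \<lambda>x. 1 :: real)"
  have "le_constraints (normal_form vars param ?P) \<subseteq> ?div ` le_constraints ?P"
    "eq_constraints (normal_form vars param ?P) \<subseteq> ?div ` eq_constraints ?P"
    by (force simp: normal_form_def)+
  then have "finite (le_constraints (normal_form vars param ?P))"
    "finite (eq_constraints (normal_form vars param ?P))"
    using finite_constraints finite_subset by blast+
  moreover have "posynomial vars (\<lambda>x. l (param x) / r (param x))"
    if "(l, r) \<in> le_constraints ?P" "\<not> (\<forall>x\<in>pos_orthant vars. l (param x) / r (param x) = 0)"
    for l r
    using that(2) le_constraints_monomial[OF that(1)]
    by (intro posynomial_if_not_zero posynomial_or_zero_divide)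
  moreover have "monomial_function vars (\<lambda>x. l (param x) / r (param x))"
    if "(l, r) \<in> eq_constraints ?P" for l r
    by (intro monomial_function_divide eq_constraints_monomial[OF that])
  ultimately have "geometric_program vars (normal_form vars param ?P)"
    using finite_vars posynomial_objective unfolding geometric_program_def
    by (fastforce simp: normal_form_def)
  moreover have "bij_betw param (pos_orthant vars) (points ?P)"
    using bij_betw_param by (simp add: partition_program_def)
  ultimately show ?thesis
    unfolding is_geometric_program_def
    using le_constraints_monomial(2) eq_constraints_monomial(2) by blast
qed

end


section \<open>The bound as a geometric program\<close>

theorem theorem3p1:
  fixes f :: "'n::finite rpoly"
    and d :: nat
    and N :: "'n \<Rightarrow> real"
    and I :: "'m::finite \<Rightarrow> 'n set"
    and g :: "'m \<Rightarrow> 'n rpoly"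
    and c :: "'m \<Rightarrow> real"
  assumes "even d"
    and "d \<ge> max 2 (total_degree f)"
    and "\<And>i. N i > 0"
    and "inj I" and "partition_on UNIV (range I)"
    and "\<And>j. g j = 1 - (\<Sum>i\<in>I j. (Const (1 / N i) * Var i) ^ d)"
    and "\<And>j. c j = Max ({mcoeff f (axis i d) * N i ^ d | i. i \<in> I j} \<union> {0})"
  shows "s_bound d f g
      = ereal (mcoeff f 0 + (\<Sum>j\<in>UNIV. c j)) - optimum_value (partition_program d f N I c)
    \<and> is_geometric_program (positive_vars d f) (from_positive_vars d f)
      (partition_program d f N I c)"
proof -
  interpret ball_partition f d N I g c
    using assms by unfold_locales auto
  show ?thesis
    using s_bound_eq geometric by blast
qed

end
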